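(* Let $m\ge 1$ and let $u_0,\dots,u_{m-1},v_0,\dots,v_{m-1}$ be complex numbers with $1+u_iv_j\neq 0$ for all $i,j\in\{0,\dots,m-1\}$. Let $M_m(\vec u,\vec v)$ be the $m\times m$ matrix with entries $\frac{u_i+v_j}{1+u_iv_j}$, $0\le i,j\le m-1$. Then $$\det M_m(\vec u,\vec v)=\frac12\Bigl(\prod_{i=0}^{m-1}(1+u_i)\prod_{j=0}^{m-1}(1+v_j)+(-1)^m\prod_{i=0}^{m-1}(1-u_i)\prod_{j=0}^{m-1}(1-v_j)\Bigr)\prod_{0\le i<j\le m-1}(u_i-u_j)\prod_{0\le i<j\le m-1}(v_j-v_i)\prod_{i=0}^{m-1}\prod_{j=0}^{m-1}(1+u_iv_j)^{-1}.$$ *)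

theory Defs
  imports Complex_Main "Jordan_Normal_Form.Determinant"
begin

definition M_mat :: "nat \<Rightarrow> (nat \<Rightarrow> complex) \<Rightarrow> (nat \<Rightarrow> complex) \<Rightarrow> complex mat" where
  "M_mat m u v = mat m m (\<lambda>(i, j). (u i + v j) / (1 + u i * v j))"

end

theory Submission
  imports Defs
begin

text \<open>
  Let \<open>J\<close> be the all-ones matrix. The entries of \<open>M + J\<close> and \<open>M - J\<close> factor as
  \<open>(1 + u i) * (1 + v j) / (1 + u i * v j)\<close> and \<open>- (1 - u i) * (1 - v j) / (1 + u i * v j)\<close>,
  so both determinants are multiples of the Cauchy determinant of \<open>1 / (1 + u i * v j)\<close>.
  As \<open>J\<close> has rank one, \<open>det (M + t * J)\<close> is affine in \<open>t\<close>, and therefore \<open>det M\<close> is the mean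
  of \<open>det (M + J)\<close> and \<open>det (M - J)\<close>. The Cauchy determinant follows by induction, since
  the Schur complement of its last entry is a Cauchy matrix with rescaled rows and columns.
\<close>

text \<open>Multiples of the last row clear the last column above the pivot \<open>f n n\<close>.
  This factors the matrix into a unit upper block triangular \<open>?U\<close> and a lower block
  triangular \<open>?V\<close>.\<close>

lemma det_Schur_complement:
  fixes f :: "nat \<Rightarrow> nat \<Rightarrow> 'a :: field"
  assumes "f n n \<noteq> 0"
  shows "det (mat (Suc n) (Suc n) (\<lambda>(i, j). f i j)) =
    f n n * det (mat n n (\<lambda>(i, j). f i j - f i n * f n j / f n n))"
proof -
  define S where "S = mat n n (\<lambda>(i, j). f i j - f i n * f n j / f n n)"
  define B where "B = mat n 1 (\<lambda>(i, j). f i n / f n n)"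
  define C where "C = mat 1 n (\<lambda>(i, j). f n j)"
  define D where "D = mat 1 1 (\<lambda>_. f n n)"
  have S: "S \<in> carrier_mat n n" and B: "B \<in> carrier_mat n 1"
    and C: "C \<in> carrier_mat 1 n" and D: "D \<in> carrier_mat 1 1"
    by (auto simp: S_def B_def C_def D_def)
  let ?U = "four_block_mat (1\<^sub>m n) B (0\<^sub>m 1 n) (1\<^sub>m 1)"
  let ?V = "four_block_mat S (0\<^sub>m n 1) C D"
  have "mat (Suc n) (Suc n) (\<lambda>(i, j). f i j) = four_block_mat (S + B * C) (B * D) C D"
    using assms
    by (intro eq_matI)
      (auto simp: S_def B_def C_def D_def scalar_prod_def not_less less_Suc_eq)
  also have "\<dots> = ?U * ?V"
    using S B C D by (subst mult_four_block_mat) auto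
  also have "det \<dots> = det ?U * det ?V"
    using S B C D by (intro det_mult[of _ "n + 1"] four_block_carrier_mat) auto
  also have "det ?U = 1"
    using B by (subst det_four_block_mat_lower_left_zero[of _ n _ 1]) auto
  also have "det ?V = det S * det D"
    using S C D by (subst det_four_block_mat_upper_right_zero[of _ n _ 1]) auto
  also have "det D = f n n"
    using D by (simp add: det_single) (simp add: D_def)
  finally show ?thesis
    by (simp add: S_def)
qed

text \<open>Each Leibniz term takes one entry from every row and every column, so it collects each
  \<open>r i\<close> and each \<open>c j\<close> exactly once.\<close>

lemma det_scale_rows_cols:
  fixes f :: "nat \<Rightarrow> nat \<Rightarrow> 'a :: comm_ring_1"
  shows "det (mat n n (\<lambda>(i, j). r i * f i j * c j)) =
    (\<Prod>i<n. r i) * (\<Prod>j<n. c j) * det (mat n n (\<lambda>(i, j). f i j))"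
proof -
  have "(\<Prod>i<n. r i * f i (p i) * c (p i)) =
      (\<Prod>i<n. r i) * (\<Prod>j<n. c j) * (\<Prod>i<n. f i (p i))" if "p permutes {..<n}" for p
  proof -
    have "(\<Prod>i<n. c (p i)) = (\<Prod>j<n. c j)"
      using prod.permute[OF that, of c] by (simp add: o_def)
    then show ?thesis
      by (simp add: prod.distrib mult_ac)
  qed
  moreover have "det (mat n n (\<lambda>(i, j). g i j)) =
      (\<Sum>p | p permutes {..<n}. signof p * (\<Prod>i<n. g i (p i)))" for g :: "nat \<Rightarrow> nat \<Rightarrow> 'a"
    unfolding det_def
    by (auto simp: lessThan_atLeast0 dest: permutes_in_image intro!: sum.cong prod.cong)
  ultimately show ?thesis
    by (simp add: sum_distrib_left mult_ac)
qed

text \<open>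
  The matrix shifted by \<open>t\<close> is the Schur complement of a bordered matrix in which \<open>t\<close>
  occurs only in the last row.
\<close>
lemma det_add_const_affine:
  fixes f :: "nat \<Rightarrow> nat \<Rightarrow> 'a :: field"
  shows "\<exists>a b. \<forall>t. det (mat n n (\<lambda>(i, j). f i j + t)) = a + b * t"
proof -
  \<comment> \<open>With border column 1, border row \<open>- t\<close> and corner 1, the Schur
    correction is \<open>- (1 * (- t) / 1) = t\<close>.\<close>
  define g where "g t i j =
    (if i < n then if j < n then f i j else 1 else if j < n then - t else 1)" for t i j
  define G where "G t = mat (Suc n) (Suc n) (\<lambda>(i, j). g t i j)" for t
  \<comment> \<open>These cofactors delete row \<open>n\<close>, the only row containing
    \<open>t\<close>.\<close>
  have cof: "cofactor (G t) n j = cofactor (G 0) n j" for t j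
    by (auto simp: cofactor_def mat_delete_def G_def g_def intro!: arg_cong[of _ _ det] eq_matI)
  \<comment> \<open>Laplace expansion along row \<open>n\<close>: the corner 1 gives the constant
    term, the entries \<open>- t\<close> give the slope.\<close>
  have "det (mat n n (\<lambda>(i, j). f i j + t)) =
      cofactor (G 0) n n + (- (\<Sum>j<n. cofactor (G 0) n j)) * t" for t
  proof -
    have "mat n n (\<lambda>(i, j). f i j + t) = mat n n (\<lambda>(i, j). g t i j - g t i n * g t n j / g t n n)"
      by (auto simp: g_def)
    then have "det (mat n n (\<lambda>(i, j). f i j + t)) = det (G t)"
      unfolding G_def by (subst det_Schur_complement) (auto simp: g_def)
    also have "\<dots> = (\<Sum>j<Suc n. G t $$ (n, j) * cofactor (G t) n j)"
      by (rule laplace_expansion_row) (auto simp: G_def)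
    also have "\<dots> = (\<Sum>j<Suc n. G t $$ (n, j) * cofactor (G 0) n j)"
      by (simp only: cof[of t])
    also have "\<dots> = (\<Sum>j<n. - t * cofactor (G 0) n j) + cofactor (G 0) n n"
      by (simp add: G_def g_def)
    finally show ?thesis
      by (simp add: sum_distrib_left sum_negf mult.commute)
  qed
  then show ?thesis
    by blast
qed

lemma prod_pairs_Suc:
  fixes g :: "nat \<Rightarrow> nat \<Rightarrow> 'a :: comm_monoid_mult"
  shows "(\<Prod>(i, j)\<in>{(i, j). i < j \<and> j < Suc n}. g i j) =
    (\<Prod>(i, j)\<in>{(i, j). i < j \<and> j < n}. g i j) * (\<Prod>i<n. g i n)"
proof -
  have eq: "{(i, j). i < j \<and> j < Suc n} = {(i, j). i < j \<and> j < n} \<union> (\<lambda>i. (i, n)) ` {..<n}"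
    by auto
  have "finite {(i, j). i < j \<and> j < n}"
    by (rule finite_subset[of _ "{..<n} \<times> {..<n}"]) auto
  then show ?thesis
    unfolding eq by (subst prod.union_disjoint) (auto simp: prod.reindex inj_on_def)
qed

lemma det_Cauchy:
  fixes u v :: "nat \<Rightarrow> 'a :: field"
  assumes "\<And>i j. i < n \<Longrightarrow> j < n \<Longrightarrow> 1 + u i * v j \<noteq> 0"
  shows "det (mat n n (\<lambda>(i, j). inverse (1 + u i * v j))) =
    (\<Prod>(i, j)\<in>{(i, j). i < j \<and> j < n}. u i - u j)
    * (\<Prod>(i, j)\<in>{(i, j). i < j \<and> j < n}. v j - v i)
    * (\<Prod>i<n. \<Prod>j<n. inverse (1 + u i * v j))"
  using assms
proof (induction n)
  case 0
  then show ?case by simp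
next
  case (Suc n)
  let ?f = "\<lambda>i j. inverse (1 + u i * v j)"
  let ?r = "\<lambda>i. (u i - u n) * ?f i n" and ?c = "\<lambda>j. (v n - v j) * ?f n j"
  \<comment> \<open>After clearing denominators this is \<open>(1 + u i * v n) * (1 + u n * v j) -
    (1 + u i * v j) * (1 + u n * v n) = (u i - u n) * (v n - v j)\<close>.\<close>
  have entry: "?f i j - ?f i n * ?f n j / ?f n n = ?r i * ?f i j * ?c j" if "i < n" "j < n" for i j
  proof -
    have "1 + u i * v j \<noteq> 0" "1 + u i * v n \<noteq> 0" "1 + u n * v j \<noteq> 0" "1 + u n * v n \<noteq> 0"
      using Suc.prems that by auto
    then show ?thesis
      by (simp add: divide_simps) (simp add: algebra_simps)
  qed
  have "?f n n \<noteq> 0"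
    using Suc.prems by simp
  then have "det (mat (Suc n) (Suc n) (\<lambda>(i, j). ?f i j)) =
      ?f n n * det (mat n n (\<lambda>(i, j). ?f i j - ?f i n * ?f n j / ?f n n))"
    by (rule det_Schur_complement)
  also have "mat n n (\<lambda>(i, j). ?f i j - ?f i n * ?f n j / ?f n n) =
      mat n n (\<lambda>(i, j). ?r i * ?f i j * ?c j)"
    by (intro cong_mat) (auto simp: entry)
  also have "det \<dots> = (\<Prod>i<n. ?r i) * (\<Prod>j<n. ?c j) * det (mat n n (\<lambda>(i, j). ?f i j))"
    by (rule det_scale_rows_cols)
  also have "det (mat n n (\<lambda>(i, j). ?f i j)) =
      (\<Prod>(i, j)\<in>{(i, j). i < j \<and> j < n}. u i - u j)
      * (\<Prod>(i, j)\<in>{(i, j). i < j \<and> j < n}. v j - v i) * (\<Prod>i<n. \<Prod>j<n. ?f i j)"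
    using Suc by simp
  \<comment> \<open>The differences in \<open>?r\<close> and \<open>?c\<close> supply the pairs
    \<open>(i, n)\<close>; their inverses, with \<open>?f n n\<close>, supply the new row and column
    of the double product.\<close>
  finally show ?case
    by (simp add: prod_pairs_Suc prod.distrib mult_ac)
qed

theorem theorem3:
  fixes m :: nat and u v :: "nat \<Rightarrow> complex"
  assumes "m \<ge> 1"
    and "\<And>i j. i < m \<Longrightarrow> j < m \<Longrightarrow> 1 + u i * v j \<noteq> 0"
  shows "det (M_mat m u v) =
    1 / 2 * ((\<Prod>i<m. 1 + u i) * (\<Prod>j<m. 1 + v j)
             + (-1) ^ m * (\<Prod>i<m. 1 - u i) * (\<Prod>j<m. 1 - v j))
    * (\<Prod>(i, j)\<in>{(i, j). i < j \<and> j < m}. u i - u j)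
    * (\<Prod>(i, j)\<in>{(i, j). i < j \<and> j < m}. v j - v i)
    * (\<Prod>i<m. \<Prod>j<m. inverse (1 + u i * v j))"
proof -
  let ?M = "\<lambda>i j. (u i + v j) / (1 + u i * v j)"
  let ?c = "\<lambda>i j. inverse (1 + u i * v j)"
  define A where "A t = det (mat m m (\<lambda>(i, j). ?M i j + t))" for t
  define K where "K = det (mat m m (\<lambda>(i, j). ?c i j))"
  obtain a b where A: "A t = a + b * t" for t
    using det_add_const_affine[of m ?M] unfolding A_def by blast
  have "det (M_mat m u v) = A 0"
    by (simp add: A_def M_mat_def)
  also have "\<dots> = 1 / 2 * (A 1 + A (-1))"
    by (simp add: A)
  also have "A 1 = (\<Prod>i<m. 1 + u i) * (\<Prod>j<m. 1 + v j) * K"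
  proof -
    have "mat m m (\<lambda>(i, j). ?M i j + 1) = mat m m (\<lambda>(i, j). (1 + u i) * ?c i j * (1 + v j))"
      by (intro cong_mat) (use assms(2) in \<open>auto simp: field_simps\<close>)
    then show ?thesis
      unfolding A_def K_def by (simp only: det_scale_rows_cols)
  qed
  also have "A (-1) = (-1) ^ m * (\<Prod>i<m. 1 - u i) * (\<Prod>j<m. 1 - v j) * K"
  proof -
    \<comment> \<open>The minus sign goes into the row factor, so that the \<open>m\<close> rows
      together yield \<open>(-1) ^ m\<close>.\<close>
    have "mat m m (\<lambda>(i, j). ?M i j + - 1) =
        mat m m (\<lambda>(i, j). (- 1 * (1 - u i)) * ?c i j * (1 - v j))"
      by (intro cong_mat) (use assms(2) in \<open>auto simp: field_simps\<close>)
    then have "A (-1) = (\<Prod>i<m. - 1 * (1 - u i)) * (\<Prod>j<m. 1 - v j) * K"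
      unfolding A_def K_def by (simp only: det_scale_rows_cols)
    also have "(\<Prod>i<m. - 1 * (1 - u i)) = (-1) ^ m * (\<Prod>i<m. 1 - u i)"
      by (subst prod.distrib) simp
    finally show ?thesis .
  qed
  also have "K = (\<Prod>(i, j)\<in>{(i, j). i < j \<and> j < m}. u i - u j)
    * (\<Prod>(i, j)\<in>{(i, j). i < j \<and> j < m}. v j - v i) * (\<Prod>i<m. \<Prod>j<m. ?c i j)"
    unfolding K_def using assms(2) by (rule det_Cauchy)
  finally show ?thesis
    by (simp only: distrib_right mult.assoc)
qed

end
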